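(* Let $\alpha>-1$ and $\beta>0$. The class $\mathcal{B}_{\mathcal{H}}^0(\alpha,\beta)$ is closed under convex combinations: if $f_1,\dots,f_n\in\mathcal{B}_{\mathcal{H}}^0(\alpha,\beta)$ and $t_1,\dots,t_n\in[0,1]$ satisfy $\sum_{k=1}^n t_k=1$, then $\sum_{k=1}^n t_kf_k\in\mathcal{B}_{\mathcal{H}}^0(\alpha,\beta)$.
   Context: $\mathbb{D}=\{z\in\mathbb{C}:|z|<1\}$. $\mathcal{H}^0$ is the class of harmonic mappings $f=h+\overline{g}$ in $\mathbb{D}$, where $h,g$ are analytic in $\mathbb{D}$ with $h(0)=g(0)=0$, $h'(0)=1$ and $g'(0)=0$. For $\alpha>-1$ and $\beta>0$, $\mathcal{B}_{\mathcal{H}}^0(\alpha,\beta)$ is the set of $f=h+\overline{g}\in\mathcal{H}^0$ such that $|zh''(z)+\alpha(h'(z)-1)|\le \beta-|zg''(z)+\alpha g'(z)|$ for all $z\in\mathbb{D}$. *)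

theory Defs
  imports "HOL-Complex_Analysis.Complex_Analysis"
begin

text \<open>Mappings of the open unit disc are total functions of which only the values on
  \<open>ball 0 1\<close> are constrained. The normalization \<open>h 0 = g 0 = 0\<close> makes \<open>h\<close> and \<open>g\<close> unique
  on the disc, so quantifying existentially over them in the classes below is harmless.\<close>

definition harmonic_decomp0 ::
    "(complex \<Rightarrow> complex) \<Rightarrow> (complex \<Rightarrow> complex) \<Rightarrow> (complex \<Rightarrow> complex) \<Rightarrow> bool" where
  "harmonic_decomp0 f h g \<longleftrightarrow>
     h analytic_on ball 0 1 \<and> g analytic_on ball 0 1 \<and>
     (\<forall>z\<in>ball 0 1. f z = h z + cnj (g z)) \<and>
     h 0 = 0 \<and> g 0 = 0 \<and> deriv h 0 = 1 \<and> deriv g 0 = 0"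

definition class_H0 :: "(complex \<Rightarrow> complex) set" where
  "class_H0 = {f. \<exists>h g. harmonic_decomp0 f h g}"

definition class_BH0 :: "real \<Rightarrow> real \<Rightarrow> (complex \<Rightarrow> complex) set" where
  "class_BH0 \<alpha> \<beta> = {f \<in> class_H0. \<exists>h g. harmonic_decomp0 f h g \<and>
     (\<forall>z\<in>ball 0 1.
        norm (z * deriv (deriv h) z + of_real \<alpha> * (deriv h z - 1))
          \<le> \<beta> - norm (z * deriv (deriv g) z + of_real \<alpha> * deriv g z))}"

end

theory Submission
  imports Defs
begin

text \<open>The defining inequality of the class is a convex condition. With P u = z u'' + \<alpha>
  u', which is linear in u, it reads |P h - \<alpha>| + |P g| \<le> \<beta>. Real weights commute
  with conjugation, so the weighted sum of the maps h_k + cnj g_k splits into H + cnj G, where H and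
  G are the weighted sums of the h_k and of the g_k (\<open>harmonic_decomp0_convex_sum\<close>). As
  the weights sum to 1, the constant \<alpha> can be distributed over them, and P H - \<alpha> is
  the same weighted sum of the P h_k - \<alpha>. The triangle inequality
  (\<open>norm_convex_sum_le\<close>) then bounds the left side for H and G by an average of
  quantities that are each at most \<beta>. Linearity of P rests on termwise differentiation, once
  and twice.\<close>

lemma deriv_weighted_sum:
  fixes h :: "'i \<Rightarrow> complex \<Rightarrow> complex"
  assumes "open S" "\<And>k. k \<in> K \<Longrightarrow> h k holomorphic_on S" "z \<in> S"
  shows "deriv (\<lambda>w. \<Sum>k\<in>K. c k * h k w) z = (\<Sum>k\<in>K. c k * deriv (h k) z)"
proof (rule DERIV_imp_deriv)
  have "(h k has_field_derivative deriv (h k) z) (at z)" if "k \<in> K" for k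
    using assms that holomorphic_derivI by blast
  then show "((\<lambda>w. \<Sum>k\<in>K. c k * h k w) has_field_derivative (\<Sum>k\<in>K. c k * deriv (h k) z)) (at z)"
    by (intro DERIV_sum DERIV_cmult)
qed

text \<open>Differentiating the first-order formula again requires it near z, not just at z.
  Openness of S supplies the neighbourhood, and the first-order lemma then applies to the
  holomorphic functions \<open>deriv (h k)\<close>.\<close>

lemma deriv_deriv_weighted_sum:
  fixes h :: "'i \<Rightarrow> complex \<Rightarrow> complex"
  assumes "open S" "\<And>k. k \<in> K \<Longrightarrow> h k holomorphic_on S" "z \<in> S"
  shows "deriv (deriv (\<lambda>w. \<Sum>k\<in>K. c k * h k w)) z = (\<Sum>k\<in>K. c k * deriv (deriv (h k)) z)"
proof -
  have "eventually (\<lambda>w. w \<in> S) (nhds z)"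
    using assms by (simp add: eventually_nhds_in_open)
  then have "eventually (\<lambda>w. deriv (\<lambda>w. \<Sum>k\<in>K. c k * h k w) w = (\<Sum>k\<in>K. c k * deriv (h k) w)) (nhds z)"
    by (rule eventually_mono) (rule deriv_weighted_sum[OF assms(1,2)])
  then have "deriv (deriv (\<lambda>w. \<Sum>k\<in>K. c k * h k w)) z = deriv (\<lambda>w. \<Sum>k\<in>K. c k * deriv (h k) w) z"
    by (rule deriv_cong_ev) simp
  also have "\<dots> = (\<Sum>k\<in>K. c k * deriv (deriv (h k)) z)"
    by (rule deriv_weighted_sum) (use assms holomorphic_deriv in auto)
  finally show ?thesis .
qed

lemma norm_convex_sum_le:
  fixes a :: "'i \<Rightarrow> complex"
  assumes "\<And>k. k \<in> K \<Longrightarrow> 0 \<le> t k"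
  shows "norm (\<Sum>k\<in>K. of_real (t k) * a k) \<le> (\<Sum>k\<in>K. t k * norm (a k))"
  using norm_sum[of "\<lambda>k. of_real (t k) * a k" K] assms by (simp add: norm_mult)

text \<open>Weights are real, hence fixed by \<open>cnj\<close>, so the two parts combine
  separately. The normalization of the first part at 0 becomes the sum of the weights, which is
  1.\<close>

lemma harmonic_decomp0_convex_sum:
  assumes "\<And>k. k \<in> K \<Longrightarrow> harmonic_decomp0 (f k) (h k) (g k)" "(\<Sum>k\<in>K. t k) = 1"
  shows "harmonic_decomp0 (\<lambda>z. \<Sum>k\<in>K. of_real (t k) * f k z)
           (\<lambda>z. \<Sum>k\<in>K. of_real (t k) * h k z) (\<lambda>z. \<Sum>k\<in>K. of_real (t k) * g k z)"
proof -
  have an: "h k analytic_on ball 0 1" "g k analytic_on ball 0 1" if "k \<in> K" for k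
    using assms(1)[OF that] by (auto simp: harmonic_decomp0_def)
  then have hol: "h k holomorphic_on ball 0 1" "g k holomorphic_on ball 0 1" if "k \<in> K" for k
    using that analytic_imp_holomorphic by blast+
  have "(\<Sum>k\<in>K. complex_of_real (t k)) = 1"
    using assms(2) by (metis of_real_1 of_real_sum)
  then have "deriv (\<lambda>w. \<Sum>k\<in>K. of_real (t k) * h k w) 0 = 1"
    using assms(1) deriv_weighted_sum[of "ball 0 1" K h 0 "\<lambda>k. of_real (t k)"] hol
    by (simp add: harmonic_decomp0_def)
  moreover have "deriv (\<lambda>w. \<Sum>k\<in>K. of_real (t k) * g k w) 0 = 0"
    using assms(1) deriv_weighted_sum[of "ball 0 1" K g 0 "\<lambda>k. of_real (t k)"] hol
    by (simp add: harmonic_decomp0_def)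
  moreover have "(\<lambda>z. \<Sum>k\<in>K. of_real (t k) * h k z) analytic_on ball 0 1"
    "(\<lambda>z. \<Sum>k\<in>K. of_real (t k) * g k z) analytic_on ball 0 1"
    using an by (auto intro!: analytic_intros)
  ultimately show ?thesis
    using assms(1) by (simp add: harmonic_decomp0_def sum.distrib distrib_left)
qed

theorem theorem2p7:
  fixes \<alpha> \<beta> :: real and n :: nat
    and f :: "nat \<Rightarrow> complex \<Rightarrow> complex" and t :: "nat \<Rightarrow> real"
  assumes "\<alpha> > -1" and "\<beta> > 0"
    and "\<And>k. k \<in> {1..n} \<Longrightarrow> f k \<in> class_BH0 \<alpha> \<beta>"
    and "\<And>k. k \<in> {1..n} \<Longrightarrow> t k \<in> {0..1}"
    and "(\<Sum>k=1..n. t k) = 1"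
  shows "(\<lambda>z. \<Sum>k=1..n. of_real (t k) * f k z) \<in> class_BH0 \<alpha> \<beta>"
proof -
  define K where "K = {1..n}"
  \<comment> \<open>Leaving the constant out of z h'' + \<alpha> (h' - 1) makes one linear operator
    serve both parts; the \<alpha> is subtracted separately for h.\<close>
  define P where "P u z = z * deriv (deriv u) z + of_real \<alpha> * deriv u z" for u and z :: complex
  have "\<forall>k\<in>K. \<exists>h g. harmonic_decomp0 (f k) h g \<and>
          (\<forall>z\<in>ball 0 1. norm (P h z - of_real \<alpha>) + norm (P g z) \<le> \<beta>)"
    using assms(3) by (fastforce simp: K_def P_def class_BH0_def algebra_simps)
  then obtain h g where dec: "\<And>k. k \<in> K \<Longrightarrow> harmonic_decomp0 (f k) (h k) (g k)"
    and bound: "\<And>k z. k \<in> K \<Longrightarrow> z \<in> ball 0 1 \<Longrightarrow>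
                  norm (P (h k) z - of_real \<alpha>) + norm (P (g k) z) \<le> \<beta>"
    by metis
  define H where "H z = (\<Sum>k\<in>K. of_real (t k) * h k z)" for z
  define G where "G z = (\<Sum>k\<in>K. of_real (t k) * g k z)" for z
  have t: "0 \<le> t k" if "k \<in> K" for k
    using assms(4) that by (simp add: K_def)
  have t1: "(\<Sum>k\<in>K. t k) = 1"
    using assms(5) by (simp add: K_def)
  then have t1': "(\<Sum>k\<in>K. complex_of_real (t k)) = 1"
    by (metis of_real_1 of_real_sum)
  have decHG: "harmonic_decomp0 (\<lambda>z. \<Sum>k\<in>K. of_real (t k) * f k z) H G"
    unfolding H_def G_def using dec t1 by (rule harmonic_decomp0_convex_sum)
  have hol: "h k holomorphic_on ball 0 1" "g k holomorphic_on ball 0 1" if "k \<in> K" for k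
    using dec[OF that] by (auto simp: harmonic_decomp0_def analytic_imp_holomorphic)
  have P_sum: "P (\<lambda>z. \<Sum>k\<in>K. of_real (t k) * u k z) z = (\<Sum>k\<in>K. of_real (t k) * P (u k) z)"
    if "\<And>k. k \<in> K \<Longrightarrow> u k holomorphic_on ball 0 1" "z \<in> ball 0 1" for u z
    using deriv_weighted_sum[of "ball 0 1" K u z "\<lambda>k. of_real (t k)"]
      deriv_deriv_weighted_sum[of "ball 0 1" K u z "\<lambda>k. of_real (t k)"] that
    by (simp add: P_def sum_distrib_left sum.distrib algebra_simps)
  have "norm (P H z - of_real \<alpha>) + norm (P G z) \<le> \<beta>" if z: "z \<in> ball 0 1" for z
  proof -
    \<comment> \<open>Here \<alpha> is written as the weighted sum of copies of itself, by
      \<open>t1'\<close>.\<close>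
    have "P H z - of_real \<alpha> = (\<Sum>k\<in>K. of_real (t k) * (P (h k) z - of_real \<alpha>))"
      using P_sum[of h z] hol(1) z t1'
      by (simp add: H_def[abs_def] right_diff_distrib sum_subtractf flip: sum_distrib_right)
    moreover have "P G z = (\<Sum>k\<in>K. of_real (t k) * P (g k) z)"
      using P_sum[of g z] hol(2) z by (simp add: G_def[abs_def])
    ultimately have "norm (P H z - of_real \<alpha>) + norm (P G z)
        \<le> (\<Sum>k\<in>K. t k * norm (P (h k) z - of_real \<alpha>)) + (\<Sum>k\<in>K. t k * norm (P (g k) z))"
      using t by (simp only:) (intro add_mono norm_convex_sum_le)
    also have "\<dots> = (\<Sum>k\<in>K. t k * (norm (P (h k) z - of_real \<alpha>) + norm (P (g k) z)))"
      by (simp add: sum.distrib distrib_left)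
    also have "\<dots> \<le> (\<Sum>k\<in>K. t k * \<beta>)"
      using t bound[OF _ z] by (intro sum_mono mult_left_mono)
    also have "\<dots> = \<beta>"
      using t1 by (simp flip: sum_distrib_right)
    finally show ?thesis .
  qed
  \<comment> \<open>The pair H, G witnesses both existentials: membership in \<open>class_H0\<close>
    and the bound.\<close>
  then have "(\<lambda>z. \<Sum>k\<in>K. of_real (t k) * f k z) \<in> class_BH0 \<alpha> \<beta>"
    using decHG unfolding class_BH0_def class_H0_def P_def
    by (fastforce simp: algebra_simps)
  then show ?thesis
    by (simp add: K_def)
qed

end
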